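(* Let $V$ be a finite set and for each $v\in V$ let $$\omega_v(z)=\sum_{n=1}^\infty c_{v,n}e^{2\pi inz}z^{m_v-1}dz,\qquad c_{v,n}\in\mathbb{C},\quad m_v\in\mathbb{Z},\ m_v\ge1,$$ where $c_{v,n}=O(n^C)$ for some $C$ and each $v$. Then for any $k\ge1$, $(v_1,\dots,v_k)\in V^k$ and $z$ with $\mathrm{Im}\,z>0$ we have $$(2\pi i)^{m_{v_1}+\dots+m_{v_k}}I_{i\infty}^z(\omega_{v_k},\dots,\omega_{v_1})=(-1)^{\sum_{i=1}^k(m_{v_i}-1)}\sum_{j_1=0}^{m_{v_1}-1}\ \sum_{j_2=0}^{m_{v_2}-1+j_1}\cdots\sum_{j_k=0}^{m_{v_k}-1+j_{k-1}}(-1)^{j_k}$$ $$\times\ \frac{(m_{v_1}-1)!\,(m_{v_2}-1+j_1)!\cdots(m_{v_k}-1+j_{k-1})!}{j_1!\,j_2!\cdots j_k!}\ L(z;\omega_{v_k},\dots,\omega_{v_1};j_k,\dots,j_1).$$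
   Context: The iterated integral is $$I_{i\infty}^z(\omega_{v_k},\dots,\omega_{v_1})=\int_{i\infty}^z\omega_{v_k}(z_k)\int_{i\infty}^{z_k}\omega_{v_{k-1}}(z_{k-1})\cdots\int_{i\infty}^{z_2}\omega_{v_1}(z_1),$$ each integral being taken along the vertical line from $i\infty$ down to its upper limit. For $k\ge1$, $v_1,\dots,v_k\in V$, nonnegative integers $j_1,\dots,j_k$, with the convention $j_0=0$, one puts for $\mathrm{Im}\,z>0$ $$L(z;\omega_{v_k},\dots,\omega_{v_1};j_k,\dots,j_1)=(2\pi iz)^{j_k}\sum_{n_1,\dots,n_k\ge1}\frac{c_{v_1,n_1}\cdots c_{v_k,n_k}\,e^{2\pi i(n_1+\dots+n_k)z}}{n_1^{m_{v_1}+j_0-j_1}(n_1+n_2)^{m_{v_2}+j_1-j_2}\cdots(n_1+\dots+n_k)^{m_{v_k}+j_{k-1}-j_k}},$$ an absolutely convergent series. *)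

theory Defs
  imports "HOL-Analysis.Analysis" "HOL-Library.Landau_Symbols"
begin

text \<open>
  A form \<open>\<omega> = f(z) dz\<close> on the upper half plane is represented by its density \<open>f\<close>.
  Tuples \<open>(x\<^sub>1, \<dots>, x\<^sub>k)\<close> are functions on \<open>nat\<close>, of which only the values on \<open>{1..k}\<close> matter.
\<close>

definition omega :: "('v \<Rightarrow> nat \<Rightarrow> complex) \<Rightarrow> ('v \<Rightarrow> nat) \<Rightarrow> 'v \<Rightarrow> complex \<Rightarrow> complex" where
  "omega c m v z =
     (\<Sum>\<^sub>\<infinity>n\<in>{1..}. c v n * exp (2 * of_real pi * \<i> * of_nat n * z)) * z ^ (m v - 1)"

text \<open>
  The vertical line from \<open>i\<infinity>\<close> down to \<open>z\<close> is \<open>w = Re z + it\<close> with \<open>t\<close> running from \<open>\<infinity>\<close>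
  down to \<open>Im z\<close>, so \<open>dw = i dt\<close>; the interval integral with reversed bounds supplies the sign.
\<close>

definition vertical_integral :: "(complex \<Rightarrow> complex) \<Rightarrow> complex \<Rightarrow> complex" where
  "vertical_integral f z = (LBINT t=\<infinity>..ereal (Im z). f (Complex (Re z) t) * \<i>)"

text \<open>
  \<open>iterated_integral \<omega> k z\<close> is \<open>\<integral> \<omega>\<^sub>k(z\<^sub>k) \<integral> \<omega>\<^sub>k\<^sub>-\<^sub>1(z\<^sub>k\<^sub>-\<^sub>1) \<dots> \<integral> \<omega>\<^sub>1(z\<^sub>1)\<close>: the form with the
  highest index is outermost.
\<close>

primrec iterated_integral :: "(nat \<Rightarrow> complex \<Rightarrow> complex) \<Rightarrow> nat \<Rightarrow> complex \<Rightarrow> complex" where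
  "iterated_integral \<omega> 0 z = 1"
| "iterated_integral \<omega> (Suc k) z = vertical_integral (\<lambda>w. \<omega> (Suc k) w * iterated_integral \<omega> k w) z"

text \<open>
  \<open>L_series c m v k j z\<close> is \<open>L(z; \<omega>\<^bsub>v k\<^esub>, \<dots>, \<omega>\<^bsub>v 1\<^esub>; j k, \<dots>, j 1)\<close>, where \<open>j 0\<close> is meant to be \<open>0\<close>.
  The exponents in the denominator may be negative for arbitrary \<open>j\<close>, hence integer powers.
\<close>

definition L_series ::
    "('v \<Rightarrow> nat \<Rightarrow> complex) \<Rightarrow> ('v \<Rightarrow> nat) \<Rightarrow> (nat \<Rightarrow> 'v) \<Rightarrow> nat \<Rightarrow> (nat \<Rightarrow> nat) \<Rightarrow> complex \<Rightarrow> complex" where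
  "L_series c m v k j z =
     (2 * of_real pi * \<i> * z) ^ j k *
     (\<Sum>\<^sub>\<infinity>n \<in> {1..k} \<rightarrow>\<^sub>E {1..}.
        (\<Prod>i=1..k. c (v i) (n i)) * exp (2 * of_real pi * \<i> * of_nat (\<Sum>i=1..k. n i) * z) /
        (\<Prod>i=1..k. of_nat (\<Sum>l=1..i. n l) powi (int (m (v i)) + int (j (i - 1)) - int (j i))))"

text \<open>
  The index range of the nested sum over \<open>j\<^sub>1, \<dots>, j\<^sub>k\<close>, each bound depending on the preceding
  index, with the convention \<open>j\<^sub>0 = 0\<close>.
\<close>

definition J_range :: "('v \<Rightarrow> nat) \<Rightarrow> (nat \<Rightarrow> 'v) \<Rightarrow> nat \<Rightarrow> (nat \<Rightarrow> nat) set" where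
  "J_range m v k =
     {j \<in> {0..k} \<rightarrow>\<^sub>E UNIV. j 0 = 0 \<and> (\<forall>i\<in>{1..k}. j i \<le> m (v i) - 1 + j (i - 1))}"

lemma finite_J_range: "finite (J_range m v k)"
proof -
  have bound: "j i \<le> (\<Sum>l=1..i. m (v l))" if j: "j \<in> J_range m v k" and i: "i \<le> k" for j i
    using i
  proof (induction i)
    case 0
    then show ?case using j by (simp add: J_range_def)
  next
    case (Suc i)
    have "\<forall>i\<in>{1..k}. j i \<le> m (v i) - 1 + j (i - 1)"
      using j by (simp add: J_range_def)
    then have "j (Suc i) \<le> m (v (Suc i)) - 1 + j i"
      using Suc.prems by (metis One_nat_def Suc_le_mono atLeastAtMost_iff diff_Suc_1 le0)
    then show ?case using Suc by simp
  qed
  have "J_range m v k \<subseteq> (\<Pi>\<^sub>E i\<in>{0..k}. {0..(\<Sum>l=1..i. m (v l))})"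
  proof
    fix j assume j: "j \<in> J_range m v k"
    then have "j \<in> {0..k} \<rightarrow>\<^sub>E UNIV" by (simp add: J_range_def)
    then show "j \<in> (\<Pi>\<^sub>E i\<in>{0..k}. {0..(\<Sum>l=1..i. m (v l))})"
      using bound[OF j] by (auto simp: PiE_iff)
  qed
  then show ?thesis
    by (rule finite_subset) (intro finite_PiE; simp)
qed

end

theory Submission imports Defs begin

text \<open>
  The identity is proved by induction on the number of forms. If the integral of length \<open>k\<close> is
  the stated combination of the series \<open>L\<close> of length \<open>k\<close>, then the next integrand is a combination
  of products of \<open>\<omega>\<close> with such a series. Apart from a power of \<open>w\<close>, both factors are series in
  \<open>q = e\<^sup>2\<^sup>\<pi>\<^sup>i\<^sup>w\<close>, so the product is
  \<open>(2\<pi>i)\<^sup>j w\<^sup>p \<Sum> a e\<^sup>2\<^sup>\<pi>\<^sup>i\<^sup>N\<^sup>w\<close> with \<open>j = j k\<close>, \<open>p = m - 1 + j\<close>, the sum being over one more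
  index than before, and \<open>N\<close> being the sum of all indices.

  Term by term this is elementary: repeated integration by parts gives
  \<open>(2\<pi>i)\<^sup>p\<^sup>+\<^sup>1 \<integral> w\<^sup>p e\<^sup>2\<^sup>\<pi>\<^sup>i\<^sup>N\<^sup>w dw =
    \<Sum>q\<le>p. (-1)\<^sup>p\<^sup>+\<^sup>q p!/q! (2\<pi>iz)\<^sup>q e\<^sup>2\<^sup>\<pi>\<^sup>i\<^sup>N\<^sup>z / N\<^sup>p\<^sup>+\<^sup>1\<^sup>-\<^sup>q\<close>
  (lemmas \<open>vertical_integral_power_q_exp\<close> and \<open>power_exp_primitive_q_exp\<close>).
  The exponent \<open>p + 1 - q = m + j - q\<close> is the one that the next index \<open>q\<close> contributes to the
  denominator of \<open>L\<close>, and the bound \<open>q \<le> m - 1 + j\<close> is the one that defines its range, so the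
  outcome is the combination of series of length \<open>k + 1\<close>
  (lemma \<open>vertical_integral_omega_L_series\<close>). The sign \<open>(-1)\<^sup>p\<^sup>+\<^sup>q\<close> absorbs the old factor \<open>(-1)\<^sup>j\<close> and
  leaves \<open>(-1)\<^sup>m\<^sup>-\<^sup>1 (-1)\<^sup>q\<close>.

  What has to be justified is the interchange of the integral with the infinite series. The
  property that makes the induction work is \<open>q_summable\<close>: absolute convergence at every height
  \<open>y > 0\<close>. Since there is always room to pass from \<open>y\<close> to \<open>y / 2\<close>, it is stable under
  multiplying the coefficients by quantities of polynomial growth in \<open>N\<close>, and the same room
  dominates the integrals of the terms over the whole vertical line.
\<close>

section \<open>Powers times exponentials on a vertical line\<close>

abbreviation q_exp :: "nat \<Rightarrow> complex \<Rightarrow> complex" where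
  "q_exp N w \<equiv> exp (2 * of_real pi * \<i> * of_nat N * w)"

lemma norm_q_exp: "norm (q_exp N w) = exp (- (2 * pi * real N * Im w))"
  by (simp add: norm_exp_eq_Re)

lemma power_le_fact_times_exp:
  fixes s :: real
  assumes "s \<ge> 0"
  shows "s ^ p \<le> fact p * exp s"
proof -
  have "(\<Sum>n\<in>{p}. s ^ n /\<^sub>R fact n) \<le> (\<Sum>n. s ^ n /\<^sub>R fact n)"
    using assms by (intro sum_le_suminf summable_exp_generic) auto
  then have "s ^ p / fact p \<le> exp s"
    by (simp add: exp_def divide_inverse mult.commute)
  then show ?thesis
    by (simp add: field_simps)
qed

text \<open>
  Since \<open>N \<ge> 1\<close>, half of the decay \<open>e\<^sup>-\<^sup>2\<^sup>\<pi>\<^sup>N\<^sup>t\<close> yields a factor \<open>e\<^sup>-\<^sup>\<pi>\<^sup>N\<^sup>y\<close> that is uniform in \<open>t\<close> and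
  remains summable over \<open>N\<close>; the other half is at most \<open>e\<^sup>-\<^sup>2\<^sup>t\<close>, which outweighs the power
  of \<open>w\<close> (at most a constant times \<open>e\<^sup>t\<close>) and still leaves the integrable \<open>e\<^sup>-\<^sup>t\<close>.
\<close>

lemma norm_power_q_exp_le:
  assumes "N \<ge> 1" and "0 \<le> y" and "y \<le> Im w"
  shows "norm (w ^ p * q_exp N w)
           \<le> fact p * exp \<bar>Re w\<bar> * exp (- (pi * real N * y)) * exp (- Im w)"
proof -
  have "norm w ^ p \<le> fact p * exp (norm w)"
    by (rule power_le_fact_times_exp) simp
  also have "\<dots> \<le> fact p * exp (\<bar>Re w\<bar> + Im w)"
    using cmod_le[of w] assms by simp
  finally have 1: "norm w ^ p \<le> fact p * exp (\<bar>Re w\<bar> + Im w)" .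
  have "pi * real N * y \<le> pi * real N * Im w"
    using assms by (intro mult_left_mono) auto
  moreover have "2 * Im w \<le> pi * real N * Im w"
  proof (rule mult_right_mono)
    have "2 * 1 \<le> pi * real N"
      using assms pi_ge_two by (intro mult_mono) auto
    then show "2 \<le> pi * real N" by simp
  qed (use assms in auto)
  moreover have "2 * pi * real N * Im w = 2 * (pi * real N * Im w)"
    by simp
  ultimately have "norm (q_exp N w) \<le> exp (- (pi * real N * y) - 2 * Im w)"
    unfolding norm_q_exp exp_le_cancel_iff by linarith
  with 1 have "norm w ^ p * norm (q_exp N w)
                 \<le> (fact p * exp (\<bar>Re w\<bar> + Im w)) * exp (- (pi * real N * y) - 2 * Im w)"
    by (intro mult_mono) auto
  also have "\<dots> = fact p * exp \<bar>Re w\<bar> * exp (- (pi * real N * y)) * exp (- Im w)"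
    by (simp add: mult.assoc flip: exp_add)
  finally show ?thesis
    by (simp add: norm_mult norm_power)
qed

lemma exp_minus_set_integrable: "set_integrable lborel {y<..} (\<lambda>t::real. exp (- t))"
proof -
  have "set_integrable lborel (einterval (ereal y) \<infinity>) (\<lambda>t::real. exp (- t))"
  proof (rule interval_integral_FTC_nonneg(1))
    show "DERIV (\<lambda>t::real. - exp (- t)) x :> exp (- x)" for x
      by (auto intro!: derivative_eq_intros)
    show "(((\<lambda>t::real. - exp (- t)) \<circ> real_of_ereal) \<longlongrightarrow> - exp (- y)) (at_right (ereal y))"
      unfolding ereal_tendsto_simps by (auto intro!: tendsto_eq_intros)
    have "((\<lambda>t::real. exp (- t)) \<longlongrightarrow> 0) at_top"
      by (rule filterlim_compose[OF exp_at_bot filterlim_uminus_at_bot_at_top])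
    then show "(((\<lambda>t::real. - exp (- t)) \<circ> real_of_ereal) \<longlongrightarrow> 0) (at_left \<infinity>)"
      unfolding ereal_tendsto_simps using tendsto_minus by fastforce
  qed auto
  then show ?thesis by simp
qed

lemma vertical_line: "Complex x = (\<lambda>t. of_real x + \<i> * of_real t)"
  by (auto simp: complex_eq_iff)

lemma isCont_power_exp_vertical:
  "isCont (\<lambda>t. (Complex x t) ^ p * exp (a * Complex x t)) t"
  unfolding vertical_line by (intro continuous_intros)

lemma power_q_exp_set_integrable:
  assumes "N \<ge> 1" and "y > 0"
  shows "set_integrable lborel {y<..} (\<lambda>t. (Complex x t) ^ p * q_exp N (Complex x t))"
proof -
  have "set_integrable lborel {y<..}
          (\<lambda>t. (fact p * exp \<bar>x\<bar> * exp (- (pi * real N * y))) * exp (- t))"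
    by (intro set_integrable_mult_right exp_minus_set_integrable)
  then show ?thesis
  proof (rule set_integrable_bound)
    show "set_borel_measurable lborel {y<..} (\<lambda>t. (Complex x t) ^ p * q_exp N (Complex x t))"
      unfolding set_borel_measurable_def measurable_lborel2
      by (intro borel_measurable_continuous_on_indicator)
         (auto intro!: continuous_at_imp_continuous_on isCont_power_exp_vertical)
    show "AE t in lborel. t \<in> {y<..} \<longrightarrow>
            norm (Complex x t ^ p * q_exp N (Complex x t))
            \<le> norm (fact p * exp \<bar>x\<bar> * exp (- (pi * real N * y)) * exp (- t))"
      using norm_power_q_exp_le[of N y "Complex x t" p for t] assms by (auto simp: abs_mult)
  qed
qed

lemma power_q_exp_tendsto_0:
  assumes "N \<ge> 1"
  shows "((\<lambda>t. (Complex x t) ^ p * q_exp N (Complex x t)) \<longlongrightarrow> 0) at_top"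
proof (rule Lim_null_comparison)
  show "\<forall>\<^sub>F t in at_top. norm (Complex x t ^ p * q_exp N (Complex x t)) \<le> fact p * exp \<bar>x\<bar> * exp (- t)"
    using eventually_ge_at_top[of 0]
  proof eventually_elim
    case (elim t)
    then show ?case
      using norm_power_q_exp_le[of N 0 "Complex x t" p] assms by simp
  qed
  have "((\<lambda>t::real. exp (- t)) \<longlongrightarrow> 0) at_top"
    by (rule filterlim_compose[OF exp_at_bot filterlim_uminus_at_bot_at_top])
  then show "((\<lambda>t. fact p * exp \<bar>x\<bar> * exp (- t)) \<longlongrightarrow> 0) at_top"
    by (rule tendsto_mult_right_zero)
qed

text \<open>
  The primitive of \<open>w\<^sup>p e\<^sup>a\<^sup>w\<close> obtained by integrating by parts \<open>p\<close> times; for \<open>a = 2\<pi>iN\<close> it is the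
  one that vanishes at \<open>i\<infinity>\<close>.
\<close>

definition power_exp_primitive :: "complex \<Rightarrow> nat \<Rightarrow> complex \<Rightarrow> complex" where
  "power_exp_primitive a p w =
     (\<Sum>j\<le>p. (- 1) ^ (p + j) * (fact p / fact j) * (a * w) ^ j) * exp (a * w) / a ^ (p + 1)"

text \<open>
  A single integration by parts; it reduces the differentiation of the primitive to an
  induction on \<open>p\<close>.
\<close>

lemma power_exp_primitive_Suc:
  assumes "a \<noteq> 0"
  shows "power_exp_primitive a (Suc p) w =
           w ^ Suc p * exp (a * w) / a - of_nat (Suc p) / a * power_exp_primitive a p w"
proof -
  define S where "S = (\<Sum>j\<le>p. (- 1) ^ (p + j) * (fact p / fact j) * (a * w) ^ j)"
  have "(\<Sum>j\<le>p. (- 1) ^ (Suc p + j) * (fact (Suc p) / fact j) * (a * w) ^ j) =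
        - of_nat (Suc p) * S"
    unfolding S_def sum_distrib_left by (intro sum.cong) (auto simp: divide_simps algebra_simps)
  moreover have "1 + (of_nat p :: complex) \<noteq> 0"
    by (metis of_nat_Suc of_nat_neq_0)
  ultimately have "power_exp_primitive a (Suc p) w =
      (- of_nat (Suc p) * S + (a * w) ^ Suc p) * exp (a * w) / a ^ (Suc p + 1)"
    by (simp add: power_exp_primitive_def flip: mult_2)
  also have "\<dots> = w ^ Suc p * exp (a * w) / a - of_nat (Suc p) / a * (S * exp (a * w) / a ^ (p + 1))"
    using assms by (simp add: field_simps)
  finally show ?thesis
    by (simp add: power_exp_primitive_def S_def)
qed

lemma has_field_derivative_power_exp_primitive:
  assumes "a \<noteq> 0"
  shows "(power_exp_primitive a p has_field_derivative w ^ p * exp (a * w)) (at w)"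
proof (induction p)
  case 0
  have "power_exp_primitive a 0 = (\<lambda>w. exp (a * w) / a)"
    by (simp add: power_exp_primitive_def fun_eq_iff)
  then show ?case
    using assms by (auto intro!: derivative_eq_intros)
next
  case (Suc p)
  have "power_exp_primitive a (Suc p) =
          (\<lambda>w. w ^ Suc p * exp (a * w) / a - of_nat (Suc p) / a * power_exp_primitive a p w)"
    using power_exp_primitive_Suc[OF assms] by (simp add: fun_eq_iff)
  moreover have "((\<lambda>w. w ^ Suc p * exp (a * w) / a - of_nat (Suc p) / a * power_exp_primitive a p w)
      has_field_derivative w ^ Suc p * exp (a * w)) (at w)"
    by (rule derivative_eq_intros Suc.IH refl | use assms in \<open>simp add: field_simps\<close>)+
  ultimately show ?case by simp
qed

lemma vertical_integral_eq:
  "vertical_integral f z = - (LINT t:{Im z<..}|lborel. f (Complex (Re z) t) * \<i>)"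
  unfolding vertical_integral_def
  by (subst interval_integral_endpoints_reverse) (simp add: interval_integral_to_infinity_eq)

text \<open>
  The fundamental theorem of calculus on the half line; the boundary term at \<open>i\<infinity>\<close> vanishes because
  \<open>N \<ge> 1\<close>.
\<close>

lemma vertical_integral_power_q_exp:
  assumes "N \<ge> 1" and "Im z > 0"
  shows "vertical_integral (\<lambda>w. w ^ p * q_exp N w) z =
           power_exp_primitive (2 * of_real pi * \<i> * of_nat N) p z"
proof -
  define a :: complex where "a = 2 * of_real pi * \<i> * of_nat N"
  define F where "F = (\<lambda>t. power_exp_primitive a p (Complex (Re z) t))"
  have a: "a \<noteq> 0" using assms by (simp add: a_def)
  have deriv: "(F has_vector_derivative (Complex (Re z) t) ^ p * exp (a * Complex (Re z) t) * \<i>) (at t)"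
    for t
  proof -
    have "((\<lambda>t. Complex (Re z) t) has_vector_derivative \<i>) (at t)"
      unfolding vertical_line by (auto intro!: derivative_eq_intros)
    from field_vector_diff_chain_at[OF this has_field_derivative_power_exp_primitive[OF a]]
    show ?thesis by (simp add: F_def o_def mult_ac)
  qed
  have "(LBINT t=ereal (Im z)..\<infinity>. (Complex (Re z) t) ^ p * exp (a * Complex (Re z) t) * \<i>)
          = 0 - power_exp_primitive a p z"
  proof (rule interval_integral_FTC_integrable)
    show "isCont (\<lambda>t. Complex (Re z) t ^ p * exp (a * Complex (Re z) t) * \<i>) t" for t
      by (intro continuous_intros isCont_power_exp_vertical)
    show "set_integrable lborel (einterval (ereal (Im z)) \<infinity>)
            (\<lambda>t. Complex (Re z) t ^ p * exp (a * Complex (Re z) t) * \<i>)"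
      using power_q_exp_set_integrable[OF assms(1) assms(2), of "Re z" p]
      by (simp add: a_def)
    have "isCont F (Im z)"
      using deriv has_vector_derivative_continuous by blast
    then have "(F \<longlongrightarrow> F (Im z)) (at_right (Im z))"
      by (simp add: isCont_def filterlim_at_split)
    then show "((F \<circ> real_of_ereal) \<longlongrightarrow> power_exp_primitive a p z) (at_right (ereal (Im z)))"
      by (simp add: ereal_tendsto_simps1 F_def)
    have "((\<lambda>t. Complex (Re z) t ^ j * exp (a * Complex (Re z) t)) \<longlongrightarrow> 0) at_top" for j
      using power_q_exp_tendsto_0[OF assms(1)] by (simp add: a_def)
    then have "((\<lambda>t. (\<Sum>j\<le>p. ((- 1) ^ (p + j) * (fact p / fact j) * a ^ j / a ^ (p + 1)) *
        (Complex (Re z) t ^ j * exp (a * Complex (Re z) t)))) \<longlongrightarrow> 0) at_top"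
      by (intro tendsto_null_sum tendsto_mult_right_zero)
    moreover have "F = (\<lambda>t. (\<Sum>j\<le>p. ((- 1) ^ (p + j) * (fact p / fact j) * a ^ j / a ^ (p + 1)) *
        (Complex (Re z) t ^ j * exp (a * Complex (Re z) t))))"
      unfolding F_def power_exp_primitive_def sum_distrib_right sum_divide_distrib
      by (auto simp: fun_eq_iff power_mult_distrib intro!: sum.cong)
    ultimately show "((F \<circ> real_of_ereal) \<longlongrightarrow> 0) (at_left \<infinity>)"
      by (simp add: ereal_tendsto_simps1)
  qed (use deriv in auto)
  then show ?thesis
    by (simp add: vertical_integral_eq interval_integral_to_infinity_eq a_def)
qed

section \<open>Termwise integration of q-series\<close>

text \<open>
  Fubini for a countable index set. Enumerating the set reduces it to the theorem for series
  indexed by the natural numbers.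
\<close>

lemma integral_infsum:
  fixes f :: "'i \<Rightarrow> 'x \<Rightarrow> 'b::{banach, second_countable_topology}"
  assumes count: "countable A"
    and int: "\<And>n. n \<in> A \<Longrightarrow> integrable M (f n)"
    and pointwise: "\<And>x. x \<in> space M \<Longrightarrow> (\<lambda>n. norm (f n x)) summable_on A"
    and norms: "(\<lambda>n. \<integral>x. norm (f n x) \<partial>M) summable_on A"
  shows "integrable M (\<lambda>x. \<Sum>\<^sub>\<infinity>n\<in>A. f n x)"
    and "(\<integral>x. (\<Sum>\<^sub>\<infinity>n\<in>A. f n x) \<partial>M) = (\<Sum>\<^sub>\<infinity>n\<in>A. \<integral>x. f n x \<partial>M)"
proof -
  have "integrable M (\<lambda>x. \<Sum>\<^sub>\<infinity>n\<in>A. f n x) \<and>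
        (\<integral>x. (\<Sum>\<^sub>\<infinity>n\<in>A. f n x) \<partial>M) = (\<Sum>\<^sub>\<infinity>n\<in>A. \<integral>x. f n x \<partial>M)"
  proof (cases "finite A")
    case True
    then show ?thesis using int by simp
  next
    case False
    define g where "g = from_nat_into A"
    have bij: "bij_betw g UNIV A"
      using bij_betw_from_nat_into[OF count False] by (simp add: g_def)
    then have gA: "g i \<in> A" for i by (auto simp: bij_betw_def)
    have eq: "infsum h A = (\<Sum>i. h (g i))" if "(\<lambda>n. norm (h n)) summable_on A" for h :: "'i \<Rightarrow> 'b"
    proof -
      have "(\<lambda>i. h (g i)) summable_on UNIV"
        using abs_summable_summable[OF that] summable_on_reindex_bij_betw[OF bij] by metis
      then have "(\<lambda>i. h (g i)) sums (\<Sum>\<^sub>\<infinity>i. h (g i))"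
        by (intro has_sum_imp_sums has_sum_infsum)
      then show ?thesis
        by (simp add: sums_iff infsum_reindex_bij_betw[OF bij])
    qed
    have 1: "integrable M (f (g i))" for i using int gA by blast
    have 2: "AE x in M. summable (\<lambda>i. norm (f (g i) x))"
    proof (rule AE_I2)
      fix x assume "x \<in> space M"
      from pointwise[OF this] show "summable (\<lambda>i. norm (f (g i) x))"
        by (intro summable_on_imp_summable)
           (simp add: summable_on_reindex_bij_betw[OF bij, of "\<lambda>n. norm (f n x)"])
    qed
    have 3: "summable (\<lambda>i. \<integral>x. norm (f (g i) x) \<partial>M)"
      using norms
      by (intro summable_on_imp_summable)
         (simp add: summable_on_reindex_bij_betw[OF bij, of "\<lambda>n. \<integral>x. norm (f n x) \<partial>M"])
    have 4: "(\<Sum>\<^sub>\<infinity>n\<in>A. f n x) = (\<Sum>i. f (g i) x)" if "x \<in> space M" for x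
      using eq[OF pointwise[OF that]] .
    have "(\<lambda>n. norm (\<integral>x. f n x \<partial>M)) summable_on A"
      by (rule summable_on_comparison_test[OF norms]) (auto intro: integral_norm_bound)
    from eq[OF this] have "(\<Sum>\<^sub>\<infinity>n\<in>A. \<integral>x. f n x \<partial>M) = (\<integral>x. (\<Sum>i. f (g i) x) \<partial>M)"
      using integral_suminf[OF 1 2 3] by simp
    moreover have "integrable M (\<lambda>x. \<Sum>\<^sub>\<infinity>n\<in>A. f n x)"
      using integrable_suminf[OF 1 2 3] 4 by (simp cong: Bochner_Integration.integrable_cong)
    ultimately show ?thesis
      using 4 by (simp cong: Bochner_Integration.integral_cong)
  qed
  then show "integrable M (\<lambda>x. \<Sum>\<^sub>\<infinity>n\<in>A. f n x)"
    and "(\<integral>x. (\<Sum>\<^sub>\<infinity>n\<in>A. f n x) \<partial>M) = (\<Sum>\<^sub>\<infinity>n\<in>A. \<integral>x. f n x \<partial>M)" by auto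
qed

text \<open>
  Absolute convergence of \<open>\<Sum> a e\<^sup>2\<^sup>\<pi>\<^sup>i\<^sup>N\<^sup>w\<close> in the whole upper half plane. The exponents are a
  function \<open>N\<close> of an arbitrary index, so that multiple sums need not be collected into power
  series.
\<close>

definition q_summable :: "'i set \<Rightarrow> ('i \<Rightarrow> complex) \<Rightarrow> ('i \<Rightarrow> nat) \<Rightarrow> bool" where
  "q_summable A a N \<longleftrightarrow>
     (\<forall>y>0. (\<lambda>n. norm (a n) * exp (- (2 * pi * real (N n) * y))) summable_on A)"

lemma q_summable_norm:
  assumes "q_summable A a N" and "Im w > 0"
  shows "(\<lambda>n. norm (a n * q_exp (N n) w)) summable_on A"
  using assms by (simp add: q_summable_def norm_mult norm_q_exp)

text \<open>
  By \<open>norm_power_q_exp_le\<close>, the integrals of the norms of the terms are dominated by the series of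
  absolute values at height \<open>Im z / 2\<close>, which converges by hypothesis; this permits the
  interchange.
\<close>

lemma vertical_integral_q_series:
  fixes p :: nat
  assumes count: "countable A" and N: "\<And>n. n \<in> A \<Longrightarrow> N n \<ge> 1"
    and sum: "q_summable A a N" and z: "Im z > 0"
  defines "f \<equiv> \<lambda>w. w ^ p * (\<Sum>\<^sub>\<infinity>n\<in>A. a n * q_exp (N n) w)"
  shows "set_integrable lborel {Im z<..} (\<lambda>t. f (Complex (Re z) t))"
    and "vertical_integral f z =
           (\<Sum>\<^sub>\<infinity>n\<in>A. a n * power_exp_primitive (2 * of_real pi * \<i> * of_nat (N n)) p z)"
proof -
  define y x where "y = Im z" and "x = Re z"
  define h where "h = (\<lambda>n t. indicator {y<..} t *\<^sub>R
    (a n * ((Complex x t) ^ p * q_exp (N n) (Complex x t))))"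
  have y: "y > 0" using z by (simp add: y_def)
  have h_int: "integrable lborel (h n)" if "n \<in> A" for n
    using set_integrable_mult_right[OF power_q_exp_set_integrable[OF N[OF that] y, of x p], of "a n"]
    by (simp add: set_integrable_def h_def)
  have h_sum: "(\<lambda>n. norm (h n t)) summable_on A" for t
  proof (cases "t > y")
    case True
    have "(\<lambda>n. norm (Complex x t) ^ p * norm (a n * q_exp (N n) (Complex x t))) summable_on A"
      using True y by (intro summable_on_cmult_right q_summable_norm[OF sum]) auto
    then show ?thesis
      using True by (simp add: h_def norm_mult norm_power mult_ac)
  qed (simp add: h_def)
  have h_lint: "(\<integral>t. h n t \<partial>lborel) =
      a n * (\<integral>t. indicator {y<..} t *\<^sub>R ((Complex x t) ^ p * q_exp (N n) (Complex x t)) \<partial>lborel)"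
    for n
    unfolding h_def mult_scaleR_right[symmetric] by (rule integral_mult_right_zero)
  define K where "K = fact p * exp \<bar>x\<bar> * (LINT t:{y<..}|lborel. exp (- t))"
  have h_norms: "(\<lambda>n. \<integral>t. norm (h n t) \<partial>lborel) summable_on A"
  proof (rule summable_on_comparison_test)
    show "(\<lambda>n. K * (norm (a n) * exp (- (2 * pi * real (N n) * (y / 2))))) summable_on A"
    proof (rule summable_on_cmult_right)
      show "(\<lambda>n. norm (a n) * exp (- (2 * pi * real (N n) * (y / 2)))) summable_on A"
        using sum y half_gt_zero unfolding q_summable_def by blast
    qed
    fix n assume n: "n \<in> A"
    have "(\<integral>t. norm (h n t) \<partial>lborel) \<le>
      (\<integral>t. (norm (a n) * (fact p * exp \<bar>x\<bar> * exp (- (pi * real (N n) * y)))) *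
             (indicator {y<..} t *\<^sub>R exp (- t)) \<partial>lborel)"
    proof (rule integral_mono)
      show "integrable lborel (\<lambda>t. norm (h n t))"
        using h_int[OF n] by simp
      show "integrable lborel
         (\<lambda>t. (norm (a n) * (fact p * exp \<bar>x\<bar> * exp (- (pi * real (N n) * y)))) *
             (indicator {y<..} t *\<^sub>R exp (- t)))"
        using exp_minus_set_integrable[of y] by (simp add: set_integrable_def)
      show "norm (h n t) \<le> (norm (a n) * (fact p * exp \<bar>x\<bar> * exp (- (pi * real (N n) * y)))) *
             (indicator {y<..} t *\<^sub>R exp (- t))" for t
      proof (cases "t > y")
        case True
        then show ?thesis
          using mult_left_mono[OF norm_power_q_exp_le[OF N[OF n], of y "Complex x t" p], of "norm (a n)"] y
          by (simp add: h_def norm_mult mult_ac)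
      qed (simp add: h_def)
    qed
    also have "\<dots> = K * (norm (a n) * exp (- (2 * pi * real (N n) * (y / 2))))"
      by (simp only: integral_mult_right_zero) (simp add: K_def set_lebesgue_integral_def mult_ac)
    finally show "(\<integral>t. norm (h n t) \<partial>lborel) \<le> \<dots>" .
  qed auto
  have fh: "indicator {y<..} t *\<^sub>R f (Complex x t) = (\<Sum>\<^sub>\<infinity>n\<in>A. h n t)" for t
    by (cases "t > y") (simp_all add: f_def h_def mult.left_commute flip: infsum_cmult_right')
  note * = integral_infsum[OF count h_int h_sum h_norms]
  show "set_integrable lborel {Im z<..} (\<lambda>t. f (Complex (Re z) t))"
    using *(1) by (simp add: set_integrable_def fh flip: x_def y_def)
  have "vertical_integral f z = - ((\<integral>t. (\<Sum>\<^sub>\<infinity>n\<in>A. h n t) \<partial>lborel) * \<i>)"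
    by (simp add: vertical_integral_eq set_lebesgue_integral_def flip: x_def y_def fh)
  also have "\<dots> = (\<Sum>\<^sub>\<infinity>n\<in>A. - ((\<integral>t. h n t \<partial>lborel) * \<i>))"
    using *(2) by (simp add: infsum_uminus infsum_cmult_left')
  also have "\<dots> = (\<Sum>\<^sub>\<infinity>n\<in>A. a n * vertical_integral (\<lambda>w. w ^ p * q_exp (N n) w) z)"
    by (intro infsum_cong)
       (simp add: vertical_integral_eq set_lebesgue_integral_def h_lint flip: x_def y_def)
  also have "\<dots> = (\<Sum>\<^sub>\<infinity>n\<in>A. a n * power_exp_primitive (2 * of_real pi * \<i> * of_nat (N n)) p z)"
    by (intro infsum_cong) (simp add: vertical_integral_power_q_exp[OF N z])
  finally show "vertical_integral f z = \<dots>" .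
qed

section \<open>Operations on summable q-series\<close>

text \<open>
  A polynomial factor in \<open>N\<close> is absorbed by \<open>e\<^sup>\<pi>\<^sup>N\<^sup>y\<close>, that is, by replacing the height \<open>y\<close> with
  \<open>y / 2\<close>.
\<close>

lemma q_summable_mult_bounded:
  assumes a: "q_summable A a N" and K: "K \<ge> 0"
    and b: "\<And>n. n \<in> A \<Longrightarrow> norm (b n) \<le> K * real (N n) ^ d"
  shows "q_summable A (\<lambda>n. a n * b n) N"
  unfolding q_summable_def
proof (intro allI impI)
  fix y :: real assume y: "y > 0"
  define s where "s = pi * y"
  have s: "s > 0" using y by (simp add: s_def)
  show "(\<lambda>n. norm (a n * b n) * exp (- (2 * pi * real (N n) * y))) summable_on A"
  proof (rule summable_on_comparison_test)
    show "(\<lambda>n. (K * fact d / s ^ d) * (norm (a n) * exp (- (2 * pi * real (N n) * (y / 2)))))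
            summable_on A"
    proof (rule summable_on_cmult_right)
      show "(\<lambda>n. norm (a n) * exp (- (2 * pi * real (N n) * (y / 2)))) summable_on A"
        using a y half_gt_zero unfolding q_summable_def by blast
    qed
    fix n assume n: "n \<in> A"
    have "s ^ d * real (N n) ^ d \<le> fact d * exp (s * real (N n))"
      using power_le_fact_times_exp[of "s * real (N n)" d] s by (simp add: power_mult_distrib)
    then have "real (N n) ^ d \<le> fact d / s ^ d * exp (s * real (N n))"
      using s by (simp add: field_simps)
    then have "norm (b n) \<le> K * (fact d / s ^ d * exp (s * real (N n)))"
      using b[OF n] K by (meson mult_left_mono order_trans)
    then have "norm (a n) * norm (b n) * exp (- (2 * pi * real (N n) * y))
      \<le> norm (a n) * (K * (fact d / s ^ d * exp (s * real (N n)))) * exp (- (2 * pi * real (N n) * y))"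
      by (intro mult_right_mono mult_left_mono) auto
    also have "\<dots> = (K * fact d / s ^ d) * (norm (a n) *
                       (exp (s * real (N n)) * exp (- (2 * pi * real (N n) * y))))"
      by simp
    also have "exp (s * real (N n)) * exp (- (2 * pi * real (N n) * y)) =
               exp (- (2 * pi * real (N n) * (y / 2)))"
      by (simp add: s_def field_simps flip: exp_add)
    finally show "norm (a n * b n) * exp (- (2 * pi * real (N n) * y))
      \<le> (K * fact d / s ^ d) * (norm (a n) * exp (- (2 * pi * real (N n) * (y / 2))))"
      by (simp add: norm_mult)
  qed auto
qed

lemma q_summable_one: "q_summable {1..} (\<lambda>n. 1) (\<lambda>n. n)"
  unfolding q_summable_def
proof (intro allI impI)
  fix y :: real assume "y > 0"
  then have "summable (\<lambda>n. exp (- (2 * pi * y)) ^ n)"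
    by (intro summable_geometric) auto
  then have "(\<lambda>n. exp (- (2 * pi * y)) ^ n) summable_on UNIV"
    by (simp add: summable_on_UNIV_nonneg_real_iff)
  then have "(\<lambda>n. exp (- (2 * pi * y)) ^ n) summable_on {1..}"
    by (rule summable_on_subset) auto
  then show "(\<lambda>n. norm (1 :: complex) * exp (- (2 * pi * real n * y))) summable_on {1..}"
    by (simp add: mult_ac flip: exp_of_nat_mult)
qed

text \<open>
  The growth hypothesis on the coefficients enters only here; from now on \<open>q_summable\<close> replaces
  it.
\<close>

lemma q_summable_polynomial_growth:
  fixes c :: "nat \<Rightarrow> complex" and C :: real
  assumes "(\<lambda>n. norm (c n)) \<in> O(\<lambda>n. real n powr C)"
  shows "q_summable {1..} c (\<lambda>n. n)"
proof -
  obtain K where K: "K > 0" "\<forall>\<^sub>F n in sequentially. norm (norm (c n)) \<le> K * norm (real n powr C)"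
    using assms by (elim landau_o.bigE)
  then obtain n0 where n0: "\<And>n. n \<ge> n0 \<Longrightarrow> norm (c n) \<le> K * real n powr C"
    by (auto simp: eventually_sequentially)
  define d where "d = nat \<lceil>C\<rceil>"
  \<comment> \<open>adding the finitely many exceptional coefficients turns the asymptotic bound into one for all indices\<close>
  define K' where "K' = K + (\<Sum>n<n0. norm (c n))"
  have K': "K' \<ge> 0" "K \<le> K'" using K by (auto simp: K'_def intro!: add_nonneg_nonneg sum_nonneg)
  have "norm (c n) \<le> K' * real n ^ d" if "n \<in> {1..}" for n
  proof (cases "n < n0")
    case True
    then have "norm (c n) \<le> (\<Sum>n<n0. norm (c n))"
      by (intro member_le_sum) auto
    also have "\<dots> \<le> K'" using K by (simp add: K'_def)
    also have "\<dots> \<le> K' * real n ^ d"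
      using K' that by (intro mult_le_cancel_left1[THEN iffD2]) auto
    finally show ?thesis .
  next
    case False
    have "real n powr C \<le> real n powr (real d)"
      using that by (intro powr_mono) (auto simp: d_def, linarith)
    then have "K * real n powr C \<le> K' * real n ^ d"
      using that K K' by (intro mult_mono) (auto simp: powr_realpow)
    then show ?thesis using n0[of n] False by auto
  qed
  from q_summable_mult_bounded[OF q_summable_one K'(1) this] show ?thesis by simp
qed

lemma abs_summable_on_times:
  fixes f :: "'a \<Rightarrow> complex" and g :: "'b \<Rightarrow> complex"
  assumes "(\<lambda>x. norm (f x)) summable_on A" and "(\<lambda>y. norm (g y)) summable_on B"
  shows "(\<lambda>z. norm (case z of (x, y) \<Rightarrow> f x * g y)) summable_on A \<times> B"
    and "(\<Sum>\<^sub>\<infinity>(x, y)\<in>A \<times> B. f x * g y) = infsum f A * infsum g B"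
proof -
  show *: "(\<lambda>z. norm (case z of (x, y) \<Rightarrow> f x * g y)) summable_on A \<times> B"
    unfolding Infinite_Sum.abs_summable_on_Sigma_iff using assms
    by (auto simp: norm_mult infsum_cmult_right' infsum_nonneg
             intro!: summable_on_cmult_right summable_on_cmult_left)
  have "(\<Sum>\<^sub>\<infinity>x\<in>A. \<Sum>\<^sub>\<infinity>y\<in>B. f x * g y) = (\<Sum>\<^sub>\<infinity>(x, y)\<in>A \<times> B. f x * g y)"
    using abs_summable_summable[OF *] by (rule infsum_Sigma'_banach)
  then show "(\<Sum>\<^sub>\<infinity>(x, y)\<in>A \<times> B. f x * g y) = infsum f A * infsum g B"
    by (simp add: infsum_cmult_right' infsum_cmult_left')
qed

lemma q_summable_times:
  assumes "q_summable A a N" and "q_summable B b M"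
  shows "q_summable (A \<times> B) (\<lambda>(l, n). a l * b n) (\<lambda>(l, n). N l + M n)"
  unfolding q_summable_def
proof (intro allI impI)
  fix y :: real assume y: "y > 0"
  have "(\<lambda>x. norm (case x of (l, n) \<Rightarrow>
            (a l * q_exp (N l) (Complex 0 y)) * (b n * q_exp (M n) (Complex 0 y))))
          summable_on A \<times> B"
    using assms y by (intro abs_summable_on_times q_summable_norm) auto
  then show "(\<lambda>n. norm (case n of (l, n) \<Rightarrow> a l * b n) *
      exp (- (2 * pi * real (case n of (l, n) \<Rightarrow> N l + M n) * y))) summable_on A \<times> B"
    by (rule summable_on_cong[THEN iffD1, rotated])
       (auto simp: norm_mult norm_q_exp algebra_simps simp flip: exp_add)
qed

lemma q_series_mult:
  assumes "q_summable A a N" and "q_summable B b M" and "Im w > 0"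
  shows "(\<Sum>\<^sub>\<infinity>l\<in>A. a l * q_exp (N l) w) * (\<Sum>\<^sub>\<infinity>n\<in>B. b n * q_exp (M n) w) =
           (\<Sum>\<^sub>\<infinity>(l, n)\<in>A \<times> B. (a l * b n) * q_exp (N l + M n) w)"
proof -
  have "(\<Sum>\<^sub>\<infinity>(l, n)\<in>A \<times> B. (a l * b n) * q_exp (N l + M n) w) =
        (\<Sum>\<^sub>\<infinity>(l, n)\<in>A \<times> B. (a l * q_exp (N l) w) * (b n * q_exp (M n) w))"
    by (intro infsum_cong) (auto simp: algebra_simps exp_add)
  also have "\<dots> = (\<Sum>\<^sub>\<infinity>l\<in>A. a l * q_exp (N l) w) * (\<Sum>\<^sub>\<infinity>n\<in>B. b n * q_exp (M n) w)"
    using assms by (intro abs_summable_on_times q_summable_norm)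
  finally show ?thesis ..
qed

lemma infsum_sum_commute:
  fixes f :: "'i \<Rightarrow> 'a \<Rightarrow> complex"
  assumes "finite I" and "\<And>i. i \<in> I \<Longrightarrow> f i summable_on A"
  shows "(\<Sum>\<^sub>\<infinity>n\<in>A. \<Sum>i\<in>I. f i n) = (\<Sum>i\<in>I. infsum (f i) A)"
    and "(\<lambda>n. \<Sum>i\<in>I. f i n) summable_on A"
proof -
  have "(\<Sum>\<^sub>\<infinity>n\<in>A. \<Sum>i\<in>I. f i n) = (\<Sum>i\<in>I. infsum (f i) A) \<and> (\<lambda>n. \<Sum>i\<in>I. f i n) summable_on A"
    using assms
    by (induction I rule: finite_induct) (auto simp: infsum_add intro!: summable_on_add)
  then show "(\<Sum>\<^sub>\<infinity>n\<in>A. \<Sum>i\<in>I. f i n) = (\<Sum>i\<in>I. infsum (f i) A)"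
    and "(\<lambda>n. \<Sum>i\<in>I. f i n) summable_on A" by auto
qed

section \<open>The multiple series L\<close>

abbreviation multi_indices :: "nat \<Rightarrow> (nat \<Rightarrow> nat) set" where
  "multi_indices k \<equiv> {1..k} \<rightarrow>\<^sub>E {1..}"

lemma bij_betw_multi_indices_Suc:
  "bij_betw (\<lambda>(l, n). n(Suc k := l)) ({1..} \<times> multi_indices k) (multi_indices (Suc k))"
proof -
  have "{1..Suc k} = insert (Suc k) {1..k}" by auto
  then show ?thesis
    unfolding bij_betw_def by (simp only: PiE_insert_eq) (auto intro!: inj_combinator)
qed

text \<open>
  The coefficient of \<open>exp (2\<pi>i (n 1 + \<dots> + n k) z)\<close> in the multiple series that defines \<open>L\<close>.
\<close>

definition L_coeff ::
    "('v \<Rightarrow> nat \<Rightarrow> complex) \<Rightarrow> ('v \<Rightarrow> nat) \<Rightarrow> (nat \<Rightarrow> 'v) \<Rightarrow> nat \<Rightarrow> (nat \<Rightarrow> nat) \<Rightarrow>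
     (nat \<Rightarrow> nat) \<Rightarrow> complex" where
  "L_coeff c m v k j n =
     (\<Prod>i=1..k. c (v i) (n i)) /
     (\<Prod>i=1..k. of_nat (\<Sum>l=1..i. n l) powi (int (m (v i)) + int (j (i - 1)) - int (j i)))"

lemma L_series_eq:
  "L_series c m v k j z = (2 * of_real pi * \<i> * z) ^ j k *
     (\<Sum>\<^sub>\<infinity>n\<in>multi_indices k. L_coeff c m v k j n * q_exp (\<Sum>i=1..k. n i) z)"
  by (simp add: L_series_def L_coeff_def)

text \<open>
  Only the last partial sum involves the new index \<open>l\<close>, so the earlier factors are those of
  length \<open>k\<close>.
\<close>

lemma L_coeff_Suc:
  "L_coeff c m v (Suc k) j (n(Suc k := l)) =
     c (v (Suc k)) l * L_coeff c m v k j n *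
     (1 / of_nat (l + (\<Sum>i=1..k. n i)) powi (int (m (v (Suc k))) + int (j k) - int (j (Suc k))))"
proof -
  have "(\<Prod>i=1..k. of_nat (\<Sum>i'=1..i. (n(Suc k := l)) i') powi e i) =
        (\<Prod>i=1..k. (of_nat (\<Sum>i'=1..i. n i') :: complex) powi e i)" for e
    by (intro prod.cong refl arg_cong2[of _ _ _ _ "(powi)"] arg_cong[of _ _ of_nat] sum.cong) auto
  then show ?thesis
    by (simp add: L_coeff_def add.commute)
qed

lemma L_coeff_cong:
  "(\<And>i. i \<le> k \<Longrightarrow> j i = j' i) \<Longrightarrow> L_coeff c m v k j n = L_coeff c m v k j' n"
  unfolding L_coeff_def by (intro arg_cong2[of _ _ _ _ "(/)"] prod.cong refl) auto

lemma norm_inverse_powi_le: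
  assumes "N \<ge> 1"
  shows "norm (1 / of_nat N powi e :: complex) \<le> 1 * real N ^ nat \<bar>e\<bar>"
proof (cases "e \<ge> 0")
  case True
  have "1 / real N ^ nat e \<le> 1"
    using assms by simp
  also have "1 \<le> real N ^ nat \<bar>e\<bar>"
    using assms by simp
  finally show ?thesis
    using True by (simp add: power_int_def norm_divide norm_power)
next
  case False
  then show ?thesis
    by (simp add: power_int_def norm_divide norm_power norm_inverse divide_inverse power_inverse)
qed

text \<open>
  Each new index multiplies two summable families and then inserts a power of the new total
  exponent \<open>N\<close>. That power may have either sign, as the indices \<open>j\<close> are arbitrary here, but it
  is of polynomial growth in any case.
\<close>

lemma q_summable_L_coeff:
  assumes "\<And>i. i \<in> {1..k} \<Longrightarrow> q_summable {1..} (c (v i)) (\<lambda>n. n)"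
  shows "q_summable (multi_indices k) (L_coeff c m v k j) (\<lambda>n. \<Sum>i=1..k. n i)"
  using assms
proof (induction k)
  case 0
  then show ?case by (simp add: q_summable_def)
next
  case (Suc k)
  have "q_summable ({1..} \<times> multi_indices k) (\<lambda>x. (case x of (l, n) \<Rightarrow> c (v (Suc k)) l * L_coeff c m v k j n) *
      (1 / of_nat (case x of (l, n) \<Rightarrow> l + (\<Sum>i=1..k. n i)) powi
         (int (m (v (Suc k))) + int (j k) - int (j (Suc k)))))
      (\<lambda>(l, n). l + (\<Sum>i=1..k. n i))"
    using Suc by (intro q_summable_mult_bounded[OF _ zero_le_one norm_inverse_powi_le] q_summable_times)
                 auto
  then show ?case
    unfolding q_summable_def summable_on_reindex_bij_betw[OF bij_betw_multi_indices_Suc, symmetric]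
    by (elim all_forward imp_forward)
       (auto simp: L_coeff_Suc add.commute case_prod_unfold cong: summable_on_cong)
qed

section \<open>Linearity of the vertical integral\<close>

lemma vertical_integral_cong:
  assumes "\<And>w. Im w > Im z \<Longrightarrow> f w = g w"
  shows "vertical_integral f z = vertical_integral g z"
  unfolding vertical_integral_eq set_lebesgue_integral_def
  by (intro arg_cong[of _ _ uminus] Bochner_Integration.integral_cong) (auto simp: assms indicator_def)

lemma vertical_integral_mult_left:
  "vertical_integral (\<lambda>w. a * f w) z = a * vertical_integral f z"
  by (simp add: vertical_integral_eq mult.assoc)

text \<open>
  Integrability of each summand matters: linearity of the integral can fail for the default value
  assigned to a function that is not integrable.
\<close>

lemma vertical_integral_sum:
  assumes "finite J"
    and "\<And>j. j \<in> J \<Longrightarrow> set_integrable lborel {Im z<..} (\<lambda>t. f j (Complex (Re z) t))"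
  shows "vertical_integral (\<lambda>w. \<Sum>j\<in>J. a j * f j w) z = (\<Sum>j\<in>J. a j * vertical_integral (f j) z)"
proof -
  define g where "g = (\<lambda>j t. (indicator {Im z<..} t *\<^sub>R f j (Complex (Re z) t)) * \<i>)"
  have g: "integrable lborel (g j)" if "j \<in> J" for j
    using assms(2)[OF that] by (simp add: g_def set_integrable_def del: mult_scaleR_left)
  have "vertical_integral (\<lambda>w. \<Sum>j\<in>J. a j * f j w) z = - (\<integral>t. (\<Sum>j\<in>J. a j * g j t) \<partial>lborel)"
    by (simp add: vertical_integral_eq set_lebesgue_integral_def g_def sum_distrib_left
        sum_distrib_right scaleR_sum_right mult_ac)
  also have "\<dots> = - (\<Sum>j\<in>J. a j * (\<integral>t. g j t \<partial>lborel))"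
    using g by (subst Bochner_Integration.integral_sum) auto
  also have "\<dots> = (\<Sum>j\<in>J. a j * vertical_integral (f j) z)"
    unfolding vertical_integral_eq set_lebesgue_integral_def g_def mult_scaleR_left
    by (simp add: sum_negf)
  finally show ?thesis .
qed

section \<open>Integrating a form times an L-series\<close>

text \<open>
  With \<open>a = 2\<pi>iN\<close> the powers of \<open>2\<pi>i\<close> cancel except for those that accompany \<open>z\<close>, leaving
  the pure powers of \<open>N\<close> that occur in \<open>L\<close>.
\<close>

lemma power_exp_primitive_q_exp:
  assumes "N \<ge> 1"
  shows "(2 * of_real pi * \<i>) ^ (p + 1) * power_exp_primitive (2 * of_real pi * \<i> * of_nat N) p z =
     (\<Sum>q\<le>p. (- 1) ^ (p + q) * (fact p / fact q) * (2 * of_real pi * \<i> * z) ^ q *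
               (q_exp N z / of_nat N ^ (p + 1 - q)))"
proof -
  define W :: complex where "W = 2 * of_real pi * \<i>"
  have W: "W \<noteq> 0" by (simp add: W_def)
  have N: "(of_nat N :: complex) \<noteq> 0" using assms by simp
  have "W ^ (p + 1) * power_exp_primitive (W * of_nat N) p z =
     (\<Sum>q\<le>p. (- 1) ^ (p + q) * (fact p / fact q) * (W * of_nat N * z) ^ q) * exp (W * of_nat N * z)
       / of_nat N ^ (p + 1)"
    using W by (simp add: power_exp_primitive_def power_mult_distrib)
  also have "\<dots> = (\<Sum>q\<le>p. (- 1) ^ (p + q) * (fact p / fact q) * (W * z) ^ q *
               (exp (W * of_nat N * z) / of_nat N ^ (p + 1 - q)))"
    unfolding sum_distrib_right sum_divide_distrib
  proof (rule sum.cong)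
    fix q assume "q \<in> {..p}"
    then have "of_nat N ^ (p + 1) = (of_nat N ^ q * of_nat N ^ (p + 1 - q) :: complex)"
      by (simp flip: power_add)
    then show "(- 1) ^ (p + q) * (fact p / fact q) * (W * of_nat N * z) ^ q * exp (W * of_nat N * z)
       / of_nat N ^ (p + 1) = (- 1) ^ (p + q) * (fact p / fact q) * (W * z) ^ q *
               (exp (W * of_nat N * z) / of_nat N ^ (p + 1 - q))"
      using N by (simp add: power_mult_distrib)
  qed simp
  finally show ?thesis by (simp add: W_def)
qed

text \<open>
  The series of length \<open>k + 1\<close> in the shape in which termwise integration produces it: the new
  index is split off, and the new exponent is a natural number because \<open>q\<close> lies in its range.
\<close>

lemma L_series_Suc:
  assumes "m (v (Suc k)) \<ge> 1" and "q \<le> m (v (Suc k)) - 1 + j k"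
  shows "L_series c m v (Suc k) (j(Suc k := q)) z = (2 * of_real pi * \<i> * z) ^ q *
     (\<Sum>\<^sub>\<infinity>(l, n)\<in>{1..} \<times> multi_indices k. c (v (Suc k)) l * L_coeff c m v k j n *
        (q_exp (l + (\<Sum>i=1..k. n i)) z /
         of_nat (l + (\<Sum>i=1..k. n i)) ^ (m (v (Suc k)) - 1 + j k + 1 - q)))"
proof -
  have powi: "int (m (v (Suc k))) + int (j k) - int q = int (m (v (Suc k)) - 1 + j k + 1 - q)"
    using assms by simp
  have L: "L_coeff c m v k (j(Suc k := q)) n = L_coeff c m v k j n" for n
    by (rule L_coeff_cong) simp
  have S: "(\<Sum>i=1..Suc k. (n(Suc k := l)) i) = l + (\<Sum>i=1..k. n i)" for n :: "nat \<Rightarrow> nat" and l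
    by (simp add: add.commute)
  have "L_series c m v (Suc k) (j(Suc k := q)) z = (2 * of_real pi * \<i> * z) ^ q *
     (\<Sum>\<^sub>\<infinity>x\<in>{1..} \<times> multi_indices k.
        L_coeff c m v (Suc k) (j(Suc k := q)) ((\<lambda>(l, n). n(Suc k := l)) x) *
        q_exp (\<Sum>i=1..Suc k. ((\<lambda>(l, n). n(Suc k := l)) x) i) z)"
    unfolding L_series_eq
    by (subst infsum_reindex_bij_betw[OF bij_betw_multi_indices_Suc]) simp
  also have "\<dots> = (2 * of_real pi * \<i> * z) ^ q *
     (\<Sum>\<^sub>\<infinity>(l, n)\<in>{1..} \<times> multi_indices k. c (v (Suc k)) l * L_coeff c m v k j n *
        (q_exp (l + (\<Sum>i=1..k. n i)) z /
         of_nat (l + (\<Sum>i=1..k. n i)) ^ (m (v (Suc k)) - 1 + j k + 1 - q)))"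
    by (intro arg_cong2[of _ _ _ _ "(*)"] infsum_cong refl)
       (simp only: case_prod_unfold L_coeff_Suc L S fun_upd_same fun_upd_other n_not_Suc_n
          not_False_eq_True powi power_int_of_nat, simp)
  finally show ?thesis .
qed

text \<open>
  The inductive step for one choice of \<open>j\<close>: integrating \<open>\<omega>\<close> times a series of length \<open>k\<close> yields
  every admissible value \<open>q\<close> of the next index.
\<close>

lemma
  fixes c :: "'v \<Rightarrow> nat \<Rightarrow> complex" and m :: "'v \<Rightarrow> nat" and v :: "nat \<Rightarrow> 'v" and j :: "nat \<Rightarrow> nat"
  assumes c: "\<And>i. i \<in> {1..Suc k} \<Longrightarrow> q_summable {1..} (c (v i)) (\<lambda>n. n)"
    and m: "m (v (Suc k)) \<ge> 1" and z: "Im z > 0"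
  defines "p \<equiv> m (v (Suc k)) - 1 + j k"
    and "f \<equiv> \<lambda>w. omega c m (v (Suc k)) w * L_series c m v k j w"
  shows set_integrable_omega_L_series:
      "set_integrable lborel {Im z<..} (\<lambda>t. f (Complex (Re z) t))"
    and vertical_integral_omega_L_series:
      "(2 * of_real pi * \<i>) ^ m (v (Suc k)) * vertical_integral f z =
         (\<Sum>q\<le>p. (- 1) ^ (p + q) * (fact p / fact q) * L_series c m v (Suc k) (j(Suc k := q)) z)"
proof -
  define W :: complex where "W = 2 * of_real pi * \<i>"
  define A where "A = {1::nat..} \<times> multi_indices k"
  define a where "a = (\<lambda>x. case x of (l, n) \<Rightarrow> c (v (Suc k)) l * L_coeff c m v k j n)"
  define N where "N = (\<lambda>x. case x of (l, n) \<Rightarrow> l + (\<Sum>i=1..k. n i :: nat))"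
  define g where "g = (\<lambda>w. w ^ p * (\<Sum>\<^sub>\<infinity>x\<in>A. a x * q_exp (N x) w))"
  have cv: "q_summable {1..} (c (v (Suc k))) (\<lambda>n. n)"
    using c by simp
  have Lv: "q_summable (multi_indices k) (L_coeff c m v k j) (\<lambda>n. \<Sum>i=1..k. n i)"
    using c by (intro q_summable_L_coeff) auto
  have count: "countable A"
    unfolding A_def by (intro countable_SIGMA countable_PiE) auto
  have N1: "N x \<ge> 1" if "x \<in> A" for x
    using that by (auto simp: A_def N_def)
  have sum: "q_summable A a N"
    unfolding A_def a_def N_def by (rule q_summable_times[OF cv Lv])
  have fg: "f w = W ^ j k * g w" if "Im w > 0" for w
  proof -
    have "(\<Sum>\<^sub>\<infinity>x\<in>A. a x * q_exp (N x) w) =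
      (\<Sum>\<^sub>\<infinity>n\<in>{1..}. c (v (Suc k)) n * q_exp n w) *
      (\<Sum>\<^sub>\<infinity>n\<in>multi_indices k. L_coeff c m v k j n * q_exp (\<Sum>i=1..k. n i) w)"
      unfolding q_series_mult[OF cv Lv that] A_def a_def N_def
      by (intro infsum_cong) auto
    then show ?thesis
      by (simp add: f_def g_def omega_def L_series_eq p_def power_add power_mult_distrib W_def)
  qed
  have g_integrable: "set_integrable lborel {Im z<..} (\<lambda>t. g (Complex (Re z) t))"
    unfolding g_def by (rule vertical_integral_q_series(1)[OF count N1 sum z])
  have g_integral: "vertical_integral g z = (\<Sum>\<^sub>\<infinity>x\<in>A. a x * power_exp_primitive (W * of_nat (N x)) p z)"
    unfolding g_def W_def
    by (rule vertical_integral_q_series(2)[OF count N1 sum z])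
  have "set_integrable lborel {Im z<..} (\<lambda>t. W ^ j k * g (Complex (Re z) t))"
    by (intro set_integrable_mult_right g_integrable)
  also have "?this \<longleftrightarrow> set_integrable lborel {Im z<..} (\<lambda>t. f (Complex (Re z) t))"
    using z by (intro set_integrable_cong refl) (auto simp: fg)
  finally show "set_integrable lborel {Im z<..} (\<lambda>t. f (Complex (Re z) t))" .

  define h where "h = (\<lambda>q x. a x * (q_exp (N x) z / of_nat (N x) ^ (p + 1 - q)))"
  define b where "b = (\<lambda>q. (- 1) ^ (p + q) * (fact p / fact q) * (W * z) ^ q)"
  have h: "h q summable_on A" for q
  proof (rule abs_summable_summable, rule summable_on_comparison_test)
    show "(\<lambda>x. norm (a x * q_exp (N x) z)) summable_on A"
      by (rule q_summable_norm[OF sum z])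
    fix x assume x: "x \<in> A"
    have "1 \<le> real (N x) ^ (p + 1 - q)"
      using N1[OF x] by simp
    then have "norm (q_exp (N x) z) / real (N x) ^ (p + 1 - q) \<le> norm (q_exp (N x) z) / 1"
      using N1[OF x] by (intro divide_left_mono) auto
    from mult_left_mono[OF this norm_ge_zero[of "a x"]]
    show "norm (h q x) \<le> norm (a x * q_exp (N x) z)"
      by (simp add: h_def norm_mult norm_divide norm_power)
  qed auto
  have "vertical_integral f z = vertical_integral (\<lambda>w. W ^ j k * g w) z"
    using z by (intro vertical_integral_cong fg) auto
  also have "\<dots> = W ^ j k * (\<Sum>\<^sub>\<infinity>x\<in>A. a x * power_exp_primitive (W * of_nat (N x)) p z)"
    by (simp add: vertical_integral_mult_left g_integral)
  finally have "W ^ m (v (Suc k)) * vertical_integral f z =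
     W ^ (p + 1) * (\<Sum>\<^sub>\<infinity>x\<in>A. a x * power_exp_primitive (W * of_nat (N x)) p z)"
    using m by (simp add: p_def mult.assoc flip: power_add)
  also have "\<dots> = (\<Sum>\<^sub>\<infinity>x\<in>A. a x * (W ^ (p + 1) * power_exp_primitive (W * of_nat (N x)) p z))"
    by (simp add: mult.left_commute flip: infsum_cmult_right')
  also have "\<dots> = (\<Sum>\<^sub>\<infinity>x\<in>A. \<Sum>q\<le>p. b q * h q x)"
    by (intro infsum_cong)
       (simp only: power_exp_primitive_q_exp[OF N1] W_def b_def h_def sum_distrib_left mult.left_commute)
  also have "\<dots> = (\<Sum>q\<le>p. b q * infsum (h q) A)"
    using h by (subst infsum_sum_commute) (auto simp: infsum_cmult_right' intro: summable_on_cmult_right)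
  also have "\<dots> = (\<Sum>q\<le>p. (- 1) ^ (p + q) * (fact p / fact q) * L_series c m v (Suc k) (j(Suc k := q)) z)"
  proof (intro sum.cong refl)
    fix q assume "q \<in> {..p}"
    then have "L_series c m v (Suc k) (j(Suc k := q)) z = (W * z) ^ q * infsum (h q) A"
      using L_series_Suc[of m v k q j c z] m
      by (simp add: p_def W_def h_def a_def N_def A_def case_prod_unfold)
    then show "b q * infsum (h q) A =
        (- 1) ^ (p + q) * (fact p / fact q) * L_series c m v (Suc k) (j(Suc k := q)) z"
      by (simp add: b_def)
  qed
  finally show "(2 * of_real pi * \<i>) ^ m (v (Suc k)) * vertical_integral f z =
         (\<Sum>q\<le>p. (- 1) ^ (p + q) * (fact p / fact q) * L_series c m v (Suc k) (j(Suc k := q)) z)"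
    by (simp add: W_def)
qed

section \<open>Iterated integrals\<close>

text \<open>
  The bound on the last index depends only on the preceding one, so the index range of length
  \<open>k + 1\<close> is fibred over the range of length \<open>k\<close>.
\<close>

lemma sum_J_range_Suc:
  fixes F :: "(nat \<Rightarrow> nat) \<Rightarrow> 'a::comm_monoid_add"
  shows "sum F (J_range m v (Suc k)) =
     (\<Sum>j\<in>J_range m v k. \<Sum>q\<le>m (v (Suc k)) - 1 + j k. F (j(Suc k := q)))"
proof -
  define B where "B = Sigma (J_range m v k) (\<lambda>j. {..m (v (Suc k)) - 1 + j k})"
  have "bij_betw (\<lambda>(j, q). j(Suc k := q)) B (J_range m v (Suc k))"
  proof (rule bij_betw_byWitness[where f' = "\<lambda>j. (j(Suc k := undefined), j (Suc k))"])
    show "\<forall>x\<in>B. (\<lambda>j. (j(Suc k := undefined), j (Suc k))) (case x of (j, q) \<Rightarrow> j(Suc k := q)) = x"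
      by (auto simp: B_def J_range_def PiE_iff extensional_def fun_eq_iff)
    show "\<forall>j\<in>J_range m v (Suc k). (case (j(Suc k := undefined), j (Suc k)) of (j, q) \<Rightarrow> j(Suc k := q)) = j"
      by auto
    show "(\<lambda>(j, q). j(Suc k := q)) ` B \<subseteq> J_range m v (Suc k)"
      by (auto simp: B_def J_range_def PiE_iff extensional_def le_Suc_eq)
    show "(\<lambda>j. (j(Suc k := undefined), j (Suc k))) ` J_range m v (Suc k) \<subseteq> B"
    proof (intro image_subsetI)
      fix j assume j: "j \<in> J_range m v (Suc k)"
      then have "\<forall>i\<in>{1..Suc k}. j i \<le> m (v i) - 1 + j (i - 1)"
        by (simp add: J_range_def)
      then have "j (Suc k) \<le> m (v (Suc k)) - 1 + j k"
        by (auto dest: bspec[of _ _ "Suc k"])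
      then show "(j(Suc k := undefined), j (Suc k)) \<in> B"
        using j by (auto simp: B_def J_range_def PiE_iff extensional_def)
    qed
  qed
  then have "sum F (J_range m v (Suc k)) = (\<Sum>(j, q)\<in>B. F (j(Suc k := q)))"
    by (simp add: sum.reindex_bij_betw[symmetric] case_prod_unfold)
  also have "\<dots> = (\<Sum>j\<in>J_range m v k. \<Sum>q\<le>m (v (Suc k)) - 1 + j k. F (j(Suc k := q)))"
    unfolding B_def by (rule sum.Sigma[symmetric]) (auto simp: finite_J_range)
  finally show ?thesis .
qed

text \<open>
  The induction starts from the empty integral, where both sides equal \<open>1\<close>: the index range
  contains only the convention \<open>j 0 = 0\<close>, and the only multi-index is the empty one.
\<close>

theorem iterated_integral_eq_L_series:
  fixes c :: "'v \<Rightarrow> nat \<Rightarrow> complex" and m :: "'v \<Rightarrow> nat" and v :: "nat \<Rightarrow> 'v"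
  assumes "\<And>i. i \<in> {1..k} \<Longrightarrow> q_summable {1..} (c (v i)) (\<lambda>n. n)"
    and "\<And>i. i \<in> {1..k} \<Longrightarrow> m (v i) \<ge> 1" and "Im z > 0"
  shows "(2 * of_real pi * \<i>) ^ (\<Sum>i=1..k. m (v i)) *
           iterated_integral (\<lambda>i. omega c m (v i)) k z =
         (- 1) ^ (\<Sum>i=1..k. m (v i) - 1) *
         (\<Sum>j\<in>J_range m v k.
            (- 1) ^ j k *
            ((\<Prod>i=1..k. fact (m (v i) - 1 + j (i - 1))) / (\<Prod>i=1..k. fact (j i))) *
            L_series c m v k j z)"
  using assms
proof (induction k arbitrary: z)
  case 0
  have "J_range m v 0 = {\<lambda>i. if i = 0 then 0 else undefined}"
    by (auto simp: J_range_def PiE_iff extensional_def fun_eq_iff)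
  then show ?case
    by (simp add: L_series_def)
next
  case (Suc k)
  define W :: complex where "W = 2 * of_real pi * \<i>"
  define I where "I = iterated_integral (\<lambda>i. omega c m (v i))"
  define M where "M = (\<Sum>i=1..k. m (v i))"
  define \<mu> where "\<mu> = m (v (Suc k))"
  define s :: complex where "s = (- 1) ^ (\<Sum>i=1..k. m (v i) - 1)"
  define B :: "nat \<Rightarrow> (nat \<Rightarrow> nat) \<Rightarrow> complex" where "B = (\<lambda>k j. (- 1) ^ j k *
    ((\<Prod>i=1..k. fact (m (v i) - 1 + j (i - 1))) / (\<Prod>i=1..k. fact (j i))))"
  define f where "f = (\<lambda>j w. omega c m (v (Suc k)) w * L_series c m v k j w)"
  have IH: "W ^ M * I k w = s * (\<Sum>j\<in>J_range m v k. B k j * L_series c m v k j w)" if "Im w > 0" for w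
    using Suc.IH[of w] Suc.prems that by (simp add: W_def I_def M_def s_def B_def)
  have f_integrable: "set_integrable lborel {Im z<..} (\<lambda>t. f j (Complex (Re z) t))" for j
    unfolding f_def using Suc.prems by (intro set_integrable_omega_L_series) auto
  have f_integral: "W ^ \<mu> * vertical_integral (f j) z =
      (\<Sum>q\<le>\<mu> - 1 + j k. (- 1) ^ (\<mu> - 1 + j k + q) * (fact (\<mu> - 1 + j k) / fact q) *
        L_series c m v (Suc k) (j(Suc k := q)) z)" for j
    unfolding f_def W_def \<mu>_def using Suc.prems by (intro vertical_integral_omega_L_series) auto
  have B_Suc: "(- 1) ^ (\<mu> - 1) * B (Suc k) (j(Suc k := q)) =
      B k j * ((- 1) ^ (\<mu> - 1 + j k + q) * (fact (\<mu> - 1 + j k) / fact q))" for j q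
  proof -
    have "(\<Prod>i=1..k. fact (m (v i) - 1 + (j(Suc k := q)) (i - 1))) =
          (\<Prod>i=1..k. fact (m (v i) - 1 + j (i - 1)) :: complex)"
      by (intro prod.cong) auto
    moreover have "(\<Prod>i=1..k. fact ((j(Suc k := q)) i)) = (\<Prod>i=1..k. fact (j i) :: complex)"
      by (intro prod.cong) auto
    \<comment> \<open>the sign of the new primitive contains a second factor (-1)^j k, which cancels the old one\<close>
    moreover have "(- 1) ^ j k * (- 1) ^ (\<mu> - 1 + j k + q) = ((- 1) ^ (\<mu> - 1) * (- 1) ^ q :: complex)"
      by (simp add: power_add mult_ac flip: power_mult_distrib)
    ultimately show ?thesis
      by (simp add: B_def \<mu>_def mult_ac)
  qed
  have "W ^ (M + \<mu>) * I (Suc k) z =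
      W ^ \<mu> * vertical_integral (\<lambda>w. W ^ M * (omega c m (v (Suc k)) w * I k w)) z"
    by (simp add: vertical_integral_mult_left I_def power_add)
  also have "vertical_integral (\<lambda>w. W ^ M * (omega c m (v (Suc k)) w * I k w)) z =
      vertical_integral (\<lambda>w. \<Sum>j\<in>J_range m v k. s * B k j * f j w) z"
  proof (rule vertical_integral_cong)
    fix w assume "Im w > Im z"
    then have "Im w > 0" using Suc.prems by simp
    have "W ^ M * (omega c m (v (Suc k)) w * I k w) = omega c m (v (Suc k)) w * (W ^ M * I k w)"
      by simp
    also have "\<dots> = (\<Sum>j\<in>J_range m v k. s * B k j * f j w)"
      unfolding IH[OF \<open>Im w > 0\<close>] by (simp add: sum_distrib_left f_def mult_ac)
    finally show "W ^ M * (omega c m (v (Suc k)) w * I k w) = \<dots>" .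
  qed
  also have "W ^ \<mu> * \<dots> = (\<Sum>j\<in>J_range m v k. s * B k j * (W ^ \<mu> * vertical_integral (f j) z))"
    using f_integrable
    by (subst vertical_integral_sum) (simp_all add: finite_J_range sum_distrib_left mult_ac)
  also have "\<dots> = (\<Sum>j\<in>J_range m v k. \<Sum>q\<le>\<mu> - 1 + j k.
      s * (- 1) ^ (\<mu> - 1) * (B (Suc k) (j(Suc k := q)) * L_series c m v (Suc k) (j(Suc k := q)) z))"
  proof (intro sum.cong refl)
    fix j
    have "s * B k j * (W ^ \<mu> * vertical_integral (f j) z) = (\<Sum>q\<le>\<mu> - 1 + j k.
      s * ((- 1) ^ (\<mu> - 1) * B (Suc k) (j(Suc k := q))) * L_series c m v (Suc k) (j(Suc k := q)) z)"
      unfolding f_integral sum_distrib_left B_Suc by (simp add: mult.assoc)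
    then show "s * B k j * (W ^ \<mu> * vertical_integral (f j) z) = (\<Sum>q\<le>\<mu> - 1 + j k.
      s * (- 1) ^ (\<mu> - 1) * (B (Suc k) (j(Suc k := q)) * L_series c m v (Suc k) (j(Suc k := q)) z))"
      by (simp add: mult.assoc)
  qed
  also have "\<dots> = s * (- 1) ^ (\<mu> - 1) *
      (\<Sum>j\<in>J_range m v (Suc k). B (Suc k) j * L_series c m v (Suc k) j z)"
    by (simp add: sum_J_range_Suc sum_distrib_left \<mu>_def)
  finally show ?case
    by (simp add: W_def I_def M_def s_def B_def \<mu>_def power_add)
qed

theorem theorem3p2:
  fixes V :: "'v set"
    and c :: "'v \<Rightarrow> nat \<Rightarrow> complex"
    and m :: "'v \<Rightarrow> nat"
    and C :: real
    and k :: nat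
    and v :: "nat \<Rightarrow> 'v"
    and z :: complex
  assumes "finite V"
    and "\<And>u. u \<in> V \<Longrightarrow> m u \<ge> 1"
    and "\<And>u. u \<in> V \<Longrightarrow> (\<lambda>n. norm (c u n)) \<in> O(\<lambda>n. real n powr C)"
    and "k \<ge> 1"
    and "\<And>i. i \<in> {1..k} \<Longrightarrow> v i \<in> V"
    and "Im z > 0"
  shows "(2 * of_real pi * \<i>) ^ (\<Sum>i=1..k. m (v i)) *
           iterated_integral (\<lambda>i. omega c m (v i)) k z =
         (- 1) ^ (\<Sum>i=1..k. m (v i) - 1) *
         (\<Sum>j\<in>J_range m v k.
            (- 1) ^ j k *
            ((\<Prod>i=1..k. fact (m (v i) - 1 + j (i - 1))) / (\<Prod>i=1..k. fact (j i))) *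
            L_series c m v k j z)"
  using assms
  by (intro iterated_integral_eq_L_series q_summable_polynomial_growth) auto

end
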